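(* Let $N \in \{2,3\}$ and let $K$ be a non-degenerate pairwise Delaunay triangle mesh embedded in $\mathbb{R}^N$. Let $\tau$ be an internal vertex of $K$. Then the signed area of the circumcentric dual $\star\tau$ is positive.
   Context: A triangle mesh is a finite simplicial complex of dimension $n=2$ embedded in $\mathbb{R}^N$ which is a 2-manifold, possibly with boundary; a vertex is internal if it does not lie on the boundary. Simplices are non-degenerate; $c_\sigma$ denotes the circumcenter of a simplex $\sigma$ (taken in the affine hull of $\sigma$), with $c_\sigma=\sigma$ for a vertex $\sigma$; $\prec$ means "is a face of". Pairwise Delaunay, non-degenerate: for each pair of triangles $\lambda,\rho$ of the mesh sharing an edge $e$, flatten the pair isometrically into the plane $\mathbb{R}^2$ (using $e$ as a hinge, so that the two opposite vertices lie strictly on opposite sides of the line through $e$); then the vertex of $\rho$ not in $e$ lies strictly outside the circumcircle of $\lambda$, and vice versa. Signed area of the dual of a vertex $\tau$: for each chain $\tau\prec\sigma^1\prec\sigma^2$ with $\sigma^1$ an edge and $\sigma^2$ a triangle of the mesh, the elementary dual simplex is the (possibly degenerate) triangle with vertices $c_\tau,c_{\sigma^1},c_{\sigma^2}$. Its sign is $s=s_0 s_1$, where for $i=0,1$ (with $\sigma^0=\tau$) $s_i=+1$ if, in the affine hull of $\sigma^{i+1}$, the circumcenter $c_{\sigma^{i+1}}$ lies in the same half space relative to the affine hull of $\sigma^i$ as the vertex of $\sigma^{i+1}$ not in $\sigma^i$, and $s_i=-1$ otherwise. The signed area of $\star\tau$ is the sum, over all such chains, of $s$ times the (unsigned) area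 of the elementary dual simplex. *)

theory Defs
  imports "HOL-Analysis.Analysis"
begin

definition isometric_on :: "'a::metric_space set \<Rightarrow> ('a \<Rightarrow> 'b::metric_space) \<Rightarrow> bool" where
  "isometric_on S f \<longleftrightarrow> (\<forall>x\<in>S. \<forall>y\<in>S. dist (f x) (f y) = dist x y)"

section \<open>Triangle meshes\<close>

text \<open>Hausdorffness and second countability are automatic for subsets of a Euclidean space.\<close>

definition surface_with_boundary :: "'a::euclidean_space set \<Rightarrow> bool" where
  "surface_with_boundary S \<longleftrightarrow>
     (\<forall>x\<in>S. \<exists>U. openin (top_of_set S) U \<and> x \<in> U \<and>
        (\<exists>V :: (real^2) set. openin (top_of_set {y. 0 \<le> y $ 1}) V \<and> U homeomorphic V))"

definition surface_boundary :: "'a::euclidean_space set \<Rightarrow> 'a set" where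
  "surface_boundary S =
     {x\<in>S. \<not> (\<exists>U. openin (top_of_set S) U \<and> x \<in> U \<and>
        (\<exists>V :: (real^2) set. open V \<and> U homeomorphic V))}"

text \<open>The library's simplicial complexes are geometric (hence embedded), their simplices are
  non-degenerate, and they contain the empty set as a face of dimension $-1$.\<close>

definition triangle_mesh :: "'a::euclidean_space set set \<Rightarrow> bool" where
  "triangle_mesh K \<longleftrightarrow>
     simplicial_complex K \<and>
     (\<forall>S\<in>K. aff_dim S \<le> 2) \<and> (\<exists>S\<in>K. aff_dim S = 2) \<and>
     surface_with_boundary (\<Union>K)"

definition internal_vertex :: "'a::euclidean_space set set \<Rightarrow> 'a set \<Rightarrow> bool" where
  "internal_vertex K \<tau> \<longleftrightarrow> \<tau> \<in> K \<and> 0 simplex \<tau> \<and> \<tau> \<inter> surface_boundary (\<Union>K) = {}"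

text \<open>Meaningful when \<open>S\<close> is a facet of the simplex \<open>T\<close>.\<close>

definition opposite_vertex :: "'a::euclidean_space set \<Rightarrow> 'a set \<Rightarrow> 'a" where
  "opposite_vertex T S = (THE w. w extreme_point_of T \<and> w \<notin> S)"

section \<open>Circumcenters and half spaces\<close>

definition circumcenter :: "'a::euclidean_space set \<Rightarrow> 'a" where
  "circumcenter S =
     (THE c. c \<in> affine hull S \<and> (\<exists>r. \<forall>v. v extreme_point_of S \<longrightarrow> dist c v = r))"

definition circumradius :: "'a::euclidean_space set \<Rightarrow> real" where
  "circumradius S = (THE r. \<forall>v. v extreme_point_of S \<longrightarrow> dist (circumcenter S) v = r)"

text \<open>Open half spaces of \<open>affine hull T\<close> bounded by its hyperplane \<open>affine hull S\<close>.\<close>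

definition same_side :: "'a::euclidean_space set \<Rightarrow> 'a set \<Rightarrow> 'a \<Rightarrow> 'a \<Rightarrow> bool" where
  "same_side T S x y \<longleftrightarrow>
     (\<exists>n c. affine hull S = affine hull T \<inter> {z. n \<bullet> z = c} \<and>
        x \<in> affine hull T \<inter> {z. c < n \<bullet> z} \<and> y \<in> affine hull T \<inter> {z. c < n \<bullet> z})"

definition opposite_sides :: "'a::euclidean_space set \<Rightarrow> 'a set \<Rightarrow> 'a \<Rightarrow> 'a \<Rightarrow> bool" where
  "opposite_sides T S x y \<longleftrightarrow>
     (\<exists>n c. affine hull S = affine hull T \<inter> {z. n \<bullet> z = c} \<and>
        x \<in> affine hull T \<inter> {z. n \<bullet> z < c} \<and> y \<in> affine hull T \<inter> {z. c < n \<bullet> z})"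

section \<open>The pairwise Delaunay property\<close>

definition flattening ::
    "'a::euclidean_space set \<Rightarrow> 'a set \<Rightarrow> 'a set \<Rightarrow> ('a \<Rightarrow> real^2) \<Rightarrow> bool" where
  "flattening L R e f \<longleftrightarrow>
     isometric_on L f \<and> isometric_on R f \<and>
     opposite_sides UNIV (f ` e) (f (opposite_vertex L e)) (f (opposite_vertex R e))"

text \<open>Any two flattenings of a pair differ by an isometry of the plane, so it does not matter
  which one is used. The condition is imposed on \<open>(L, R)\<close> and on \<open>(R, L)\<close>, which gives
  both directions.\<close>

definition pairwise_delaunay :: "'a::euclidean_space set set \<Rightarrow> bool" where
  "pairwise_delaunay K \<longleftrightarrow>
     (\<forall>L\<in>K. \<forall>R\<in>K. \<forall>e\<in>K. 2 simplex L \<and> 2 simplex R \<and> 1 simplex e \<and>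
        L \<noteq> R \<and> e face_of L \<and> e face_of R \<longrightarrow>
        (\<forall>f. flattening L R e f \<longrightarrow>
           circumradius (f ` L) < dist (circumcenter (f ` L)) (f (opposite_vertex R e))))"

section \<open>Area of planar sets\<close>

text \<open>Area of a set that lies in some plane of the ambient space: the Lebesgue measure of an
  isometric copy in \<open>real^2\<close>.\<close>

definition planar_area :: "'a::euclidean_space set \<Rightarrow> real" where
  "planar_area S =
     (THE m. \<exists>f :: 'a \<Rightarrow> real^2. isometric_on S f \<and> m = measure lebesgue (f ` S))"

text \<open>For triangles, degenerate or not, this is well defined and agrees with Heron's formula.\<close>

lemma isometric_on_convex_comb:
  fixes f :: "'a::euclidean_space \<Rightarrow> 'b::euclidean_space"
  assumes f: "isometric_on S f" and S: "convex S" "x \<in> S" "y \<in> S" and t: "0 \<le> t" "t \<le> 1"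
  shows "f ((1 - t) *\<^sub>R x + t *\<^sub>R y) = (1 - t) *\<^sub>R f x + t *\<^sub>R f y"
proof -
  define z where "z = (1 - t) *\<^sub>R x + t *\<^sub>R y"
  have z: "z \<in> S"
    unfolding z_def using S t by (intro convexD) auto
  have "z - x = t *\<^sub>R (y - x)" "z - y = (1 - t) *\<^sub>R (x - y)"
    by (simp_all add: z_def algebra_simps)
  then have 1: "dist x z = t * dist x y" "dist z y = (1 - t) * dist x y"
    using t by (simp_all add: dist_norm norm_minus_commute[of x])
  have d: "dist (f x) (f z) = t * dist x y" "dist (f z) (f y) = (1 - t) * dist x y"
    "dist (f x) (f y) = dist x y"
    using f S z 1 by (auto simp: isometric_on_def)
  define p where "p = f z - f x"
  define q where "q = f y - f z"
  have pq: "norm p = t * dist x y" "norm q = (1 - t) * dist x y" "norm (p + q) = dist x y"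
    using d by (auto simp: p_def q_def dist_norm norm_minus_commute)
  then have "norm (p + q) = norm p + norm q"
    by (simp add: algebra_simps)
  then have eq: "norm p *\<^sub>R q = norm q *\<^sub>R p"
    by (simp add: norm_triangle_eq)
  show ?thesis
  proof (cases "x = y")
    case True
    then show ?thesis by (simp add: algebra_simps flip: scaleR_add_left)
  next
    case False
    have "dist x y *\<^sub>R (t *\<^sub>R q) = dist x y *\<^sub>R ((1 - t) *\<^sub>R p)"
      using eq unfolding pq by (simp add: mult.commute)
    then have "t *\<^sub>R q = (1 - t) *\<^sub>R p"
      using False by (subst (asm) scaleR_cancel_left) simp
    then have "f z = (1 - t) *\<^sub>R f x + t *\<^sub>R f y"
      by (simp add: p_def q_def algebra_simps)
    then show ?thesis by (simp add: z_def)
  qed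
qed

lemma isometric_on_convex_image:
  fixes f :: "'a::euclidean_space \<Rightarrow> 'b::euclidean_space"
  assumes f: "isometric_on S f" and S: "convex S"
  shows "convex (f ` S)"
  unfolding convex_alt
proof (intro ballI allI impI)
  fix p q and t :: real assume "p \<in> f ` S" "q \<in> f ` S" and t: "0 \<le> t \<and> t \<le> 1"
  then obtain x y where xy: "x \<in> S" "y \<in> S" "p = f x" "q = f y" by auto
  have "(1 - t) *\<^sub>R x + t *\<^sub>R y \<in> S"
    using S xy t by (intro convexD) auto
  then show "(1 - t) *\<^sub>R p + t *\<^sub>R q \<in> f ` S"
    using isometric_on_convex_comb[OF f S xy(1,2)] t xy by (metis image_eqI)
qed

lemma isometric_on_convex_hull:
  fixes f :: "'a::euclidean_space \<Rightarrow> 'b::euclidean_space"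
  assumes f: "isometric_on (convex hull X) f"
  shows "f ` (convex hull X) = convex hull (f ` X)"
proof
  let ?S = "convex hull X"
  show "convex hull (f ` X) \<subseteq> f ` ?S"
    using isometric_on_convex_image[OF f] by (intro hull_minimal) (auto simp: hull_inc)
  have inj: "inj_on f ?S"
    using f by (auto simp: isometric_on_def inj_on_def) (metis dist_eq_0_iff)
  define g where "g = inv_into ?S f"
  have gf: "g (f x) = x" if "x \<in> ?S" for x
    using inj that by (simp add: g_def)
  have sub: "convex hull (f ` X) \<subseteq> f ` ?S" by fact
  have "isometric_on (f ` ?S) g"
    using f gf by (auto simp: isometric_on_def)
  then have "isometric_on (convex hull (f ` X)) g"
    using sub unfolding isometric_on_def by blast
  then have "convex (g ` (convex hull (f ` X)))"
    by (rule isometric_on_convex_image) simp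
  moreover have "X \<subseteq> g ` (convex hull (f ` X))"
  proof
    fix x assume "x \<in> X"
    then have "x = g (f x)" "f x \<in> convex hull (f ` X)"
      using gf[of x] by (auto simp: hull_inc)
    then show "x \<in> g ` (convex hull (f ` X))" by blast
  qed
  ultimately have *: "?S \<subseteq> g ` (convex hull (f ` X))"
    by (rule hull_minimal[rotated])
  show "f ` ?S \<subseteq> convex hull (f ` X)"
  proof
    fix y assume "y \<in> f ` ?S"
    then obtain x where x: "x \<in> ?S" "y = f x" by auto
    then obtain w where w: "w \<in> convex hull (f ` X)" "x = g w" using * by auto
    then obtain x' where "x' \<in> ?S" "w = f x'" using sub by auto
    then show "y \<in> convex hull (f ` X)" using w x gf by auto
  qed
qed

lemma planar_area_triangle:
  fixes a b c :: "'a::euclidean_space"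
  defines "s \<equiv> (dist b c + dist a c + dist a b) / 2"
  shows "planar_area (convex hull {a, b, c}) =
           sqrt (s * (s - dist b c) * (s - dist a c) * (s - dist a b))"
proof -
  let ?T = "convex hull {a, b, c}"
  have area: "measure lebesgue (f ` ?T) =
      sqrt (s * (s - dist b c) * (s - dist a c) * (s - dist a b))"
    if f: "isometric_on ?T f" for f :: "'a \<Rightarrow> real^2"
  proof -
    have "f ` ?T = convex hull {f a, f b, f c}"
      using isometric_on_convex_hull[OF f] by simp
    moreover have "a \<in> ?T" "b \<in> ?T" "c \<in> ?T"
      by (auto simp: hull_inc)
    then have "dist (f b) (f c) = dist b c" "dist (f a) (f c) = dist a c"
      "dist (f a) (f b) = dist a b"
      using f by (auto simp: isometric_on_def)
    moreover have "convex hull {f a, f b, f c} \<in> sets lborel"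
      by (simp add: finite_imp_compact_convex_hull borel_compact)
    ultimately show ?thesis
      using heron[of "f a" "f b" "f c"] by (simp add: s_def)
  qed
  let ?V = "span {b - a, c - a}"
  have "dim ?V \<le> dim (UNIV :: (real^2) set)"
    using dim_le_card'[of "{b - a, c - a}"] by (simp add: card_insert_if split: if_splits)
  then obtain h :: "'a \<Rightarrow> real^2" where h: "linear h" "\<And>x. x \<in> ?V \<Longrightarrow> norm (h x) = norm x"
    using isometry_subset_subspace[of ?V "UNIV :: (real^2) set"] by auto
  have "?T \<subseteq> {x. x - a \<in> ?V}"
  proof (rule hull_minimal)
    show "{a, b, c} \<subseteq> {x. x - a \<in> ?V}"
      by (auto intro: span_base span_zero)
    have "{x. x - a \<in> ?V} = (+) a ` ?V"
      by (auto simp: image_iff) (metis add.commute diff_add_cancel)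
    then show "convex {x. x - a \<in> ?V}"
      by (simp add: subspace_imp_convex convex_translation)
  qed
  then have "x - y \<in> ?V" if "x \<in> ?T" "y \<in> ?T" for x y
    using span_diff[of "x - a" "{b - a, c - a}" "y - a"] that by auto
  then have "isometric_on ?T h"
    using h by (simp add: isometric_on_def dist_norm flip: linear_diff)
  then show ?thesis
    unfolding planar_area_def using area by (intro the_equality) metis+
qed

section \<open>Signed area of the circumcentric dual of a vertex\<close>

text \<open>If the circumcenter lies on \<open>affine hull S\<close>, the value is \<open>-1\<close>; the elementary dual
  simplex is then degenerate, so the choice does not affect the signed area.\<close>

definition side_sign :: "'a::euclidean_space set \<Rightarrow> 'a set \<Rightarrow> real" where
  "side_sign S T = (if same_side T S (circumcenter T) (opposite_vertex T S) then 1 else -1)"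

definition elementary_dual :: "'a::euclidean_space set \<Rightarrow> 'a set \<Rightarrow> 'a set \<Rightarrow> 'a set" where
  "elementary_dual \<tau> e t = convex hull {circumcenter \<tau>, circumcenter e, circumcenter t}"

definition dual_chains :: "'a::euclidean_space set set \<Rightarrow> 'a set \<Rightarrow> ('a set \<times> 'a set) set" where
  "dual_chains K \<tau> = {(e, t). e \<in> K \<and> t \<in> K \<and> 1 simplex e \<and> 2 simplex t \<and>
     \<tau> face_of e \<and> e face_of t}"

definition signed_dual_area :: "'a::euclidean_space set set \<Rightarrow> 'a set \<Rightarrow> real" where
  "signed_dual_area K \<tau> =
     (\<Sum>(e, t)\<in>dual_chains K \<tau>.
        side_sign \<tau> e * side_sign e t * planar_area (elementary_dual \<tau> e t))"

end

(* For a chain v < e < t let h be the height of the circumcenter of t over e, counted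
   positively towards the opposite vertex. The elementary dual triangle has its right angle at the
   midpoint of e, so its signed area is h |e| / 4. If two triangles share e, unfolding them into
   the plane turns the Delaunay condition into h + h' > 0. Hence the chains through a fixed edge
   have positive total area as soon as that edge lies in at least two triangles. Invariance of
   domain supplies this: near a point of e close to v the surface is planar, while e alone, or a
   single triangle with e in its boundary, is not a planar neighbourhood of such a point. *)
theory Submission
  imports Defs
begin

section \<open>Circumcenters of affinely independent vertex sets\<close>

lemma equidistant_affine_unique:
  fixes c c' :: "'a::euclidean_space"
  assumes "c \<in> affine hull S" "c' \<in> affine hull S"
    and "\<And>x. x \<in> S \<Longrightarrow> dist c x = r" "\<And>x. x \<in> S \<Longrightarrow> dist c' x = r'"
  shows "c = c'"
proof -
  \<comment> \<open>Subtracting the sphere equations around c and c' cancels the quadratic term in x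
    and leaves a linear equation with right-hand side q. It extends from S to the affine hull, hence
    to c and c' themselves, and this makes c - c' orthogonal to itself.\<close>
  define q where "q = (c \<bullet> c - c' \<bullet> c' - r\<^sup>2 + r'\<^sup>2) / 2"
  have "S \<subseteq> {x. (c - c') \<bullet> x = q}"
  proof
    fix x assume "x \<in> S"
    then have "(c - x) \<bullet> (c - x) = r\<^sup>2" "(c' - x) \<bullet> (c' - x) = r'\<^sup>2"
      using assms(3,4) by (simp_all add: dist_norm dot_square_norm)
    then show "x \<in> {x. (c - c') \<bullet> x = q}"
      by (simp add: q_def inner_diff inner_commute field_simps)
  qed
  then have "affine hull S \<subseteq> {x. (c - c') \<bullet> x = q}"
    by (simp add: hull_minimal affine_hyperplane)
  then have "(c - c') \<bullet> c = q" "(c - c') \<bullet> c' = q"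
    using assms(1,2) by auto
  then have "(c - c') \<bullet> (c - c') = 0"
    by (simp add: inner_diff_right)
  then show ?thesis by simp
qed

text \<open>Affine independence makes S exactly the set of extreme points of its hull, so a
  candidate center only has to be checked on S and uniqueness resolves the definite
  description.\<close>

lemma circumcenter_convex_hull:
  fixes c :: "'a::euclidean_space"
  assumes "\<not> affine_dependent S" "c \<in> affine hull S" "\<And>x. x \<in> S \<Longrightarrow> dist c x = r"
  shows "circumcenter (convex hull S) = c"
  unfolding circumcenter_def
proof (rule the_equality)
  show "c \<in> affine hull (convex hull S) \<and>
      (\<exists>r. \<forall>v. v extreme_point_of convex hull S \<longrightarrow> dist c v = r)"
    using assms by (auto simp: extreme_point_of_convex_hull_affine_independent)
  show "c' = c" if "c' \<in> affine hull (convex hull S) \<and>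
      (\<exists>r. \<forall>v. v extreme_point_of convex hull S \<longrightarrow> dist c' v = r)" for c'
    using that assms
    by (auto simp: extreme_point_of_convex_hull_affine_independent
        intro: equidistant_affine_unique[where S = S])
qed

lemma circumradius_convex_hull:
  fixes c :: "'a::euclidean_space"
  assumes "\<not> affine_dependent S" "c \<in> affine hull S" "\<And>x. x \<in> S \<Longrightarrow> dist c x = r" "S \<noteq> {}"
  shows "circumradius (convex hull S) = r"
  unfolding circumradius_def circumcenter_convex_hull[OF assms(1-3), simplified]
  using assms by (auto simp: extreme_point_of_convex_hull_affine_independent)

section \<open>A triangle in orthonormal coordinates along one of its edges\<close>

text \<open>For the planar triangle (0,0), (d,0), (a,b) with b > 0, this is the second coordinate of
  the circumcenter: the signed height over the edge of length d, positive towards the opposite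
  vertex.\<close>

definition circum_height :: "real \<Rightarrow> real \<Rightarrow> real \<Rightarrow> real" where
  "circum_height d a b = (a\<^sup>2 - a * d + b\<^sup>2) / (2 * b)"

text \<open>The vector u points along the edge from v to \<open>w\<close>, and n is the normal of
  the edge, in the plane of the triangle, on the side of \<open>p\<close>. The assumptions mention
  neither v nor a, so the locale predicate takes only u, n, d, b, and two triangles on one edge can
  share v, u and d.\<close>

locale triangle_frame =
  fixes v u n :: "'a::euclidean_space" and d a b :: real
  assumes uu: "u \<bullet> u = 1" and nn: "n \<bullet> n = 1" and un: "u \<bullet> n = 0"
    and d: "0 < d" and b: "0 < b"
begin

abbreviation w where "w \<equiv> v + d *\<^sub>R u"
abbreviation p where "p \<equiv> v + a *\<^sub>R u + b *\<^sub>R n"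
abbreviation h where "h \<equiv> circum_height d a b"
abbreviation edge where "edge \<equiv> convex hull {v, w}"
abbreviation triangle where "triangle \<equiv> convex hull {v, w, p}"

lemma nu: "n \<bullet> u = 0"
  using un by (simp add: inner_commute)

lemmas frame = uu nn un nu

lemma norm_frame: "norm (s *\<^sub>R u + t *\<^sub>R n) = sqrt (s\<^sup>2 + t\<^sup>2)"
  by (simp add: norm_eq_sqrt_inner inner_add frame power2_eq_square)

lemma affine_hull_edge: "affine hull {v, w} = {v + s *\<^sub>R u | s. True}"
proof (intro equalityI subsetI)
  fix x assume "x \<in> affine hull {v, w}"
  then obtain \<alpha> \<beta> where "\<alpha> + \<beta> = 1" "x = \<alpha> *\<^sub>R v + \<beta> *\<^sub>R w"
    by (auto simp: affine_hull_2)
  then have "x = v + (\<beta> * d) *\<^sub>R u"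
    by (auto simp: algebra_simps simp flip: scaleR_add_left)
  then show "x \<in> {v + s *\<^sub>R u | s. True}" by blast
next
  fix x assume "x \<in> {v + s *\<^sub>R u | s. True}"
  then obtain s where "x = v + s *\<^sub>R u" by auto
  then have "x = (1 - s / d) *\<^sub>R v + (s / d) *\<^sub>R w"
    using d by (simp add: algebra_simps)
  then show "x \<in> affine hull {v, w}"
    unfolding affine_hull_2 by force
qed

lemma affine_hull_triangle: "affine hull {v, w, p} = {v + s *\<^sub>R u + t *\<^sub>R n | s t. True}"
proof (intro equalityI subsetI)
  fix x assume "x \<in> affine hull {v, w, p}"
  then obtain \<alpha> \<beta> \<gamma> where *: "\<alpha> + \<beta> + \<gamma> = 1" "x = \<alpha> *\<^sub>R v + \<beta> *\<^sub>R w + \<gamma> *\<^sub>R p"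
    by (auto simp: affine_hull_3)
  then have \<alpha>: "\<alpha> = 1 - \<beta> - \<gamma>" by simp
  have "x = v + (\<beta> * d + \<gamma> * a) *\<^sub>R u + (\<gamma> * b) *\<^sub>R n"
    unfolding *(2) \<alpha> by (simp add: algebra_simps)
  then show "x \<in> {v + s *\<^sub>R u + t *\<^sub>R n | s t. True}" by blast
next
  fix x assume "x \<in> {v + s *\<^sub>R u + t *\<^sub>R n | s t. True}"
  then obtain s t where x: "x = v + s *\<^sub>R u + t *\<^sub>R n" by auto
  \<comment> \<open>Barycentric coordinates come from a triangular system: the n-coordinate
    determines \<gamma>, then the u-coordinate determines \<beta>.\<close>
  define \<gamma> where "\<gamma> = t / b"
  define \<beta> where "\<beta> = (s - \<gamma> * a) / d"
  have "t = \<gamma> * b" "s = \<beta> * d + \<gamma> * a"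
    using d b by (simp_all add: \<gamma>_def \<beta>_def)
  then have "x = (1 - \<beta> - \<gamma>) *\<^sub>R v + \<beta> *\<^sub>R w + \<gamma> *\<^sub>R p"
    unfolding x by (simp add: algebra_simps)
  then show "x \<in> affine hull {v, w, p}"
    unfolding affine_hull_3 by force
qed

lemma inner_n_edge: "x \<in> affine hull {v, w} \<Longrightarrow> n \<bullet> x = n \<bullet> v"
  by (auto simp: affine_hull_edge inner_add frame)

lemma p_notin: "p \<notin> affine hull {v, w}"
  using inner_n_edge[of p] b by (auto simp: inner_add frame)

lemma v_neq_w: "v \<noteq> w"
  using d uu by auto

lemma independent_triangle: "\<not> affine_dependent {v, w, p}"
  using affine_independent_insert[OF affine_independent_2 p_notin] by (simp add: insert_commute)

lemma p_notin_edge: "p \<notin> edge"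
  using p_notin convex_hull_subset_affine_hull by blast

lemma opposite_vertex_triangle: "opposite_vertex triangle edge = p"
  unfolding opposite_vertex_def extreme_point_of_convex_hull_affine_independent[OF independent_triangle]
  using p_notin_edge by (intro the_equality) (auto simp: hull_inc)

lemma opposite_vertex_edge: "opposite_vertex edge {v} = w"
  unfolding opposite_vertex_def extreme_point_of_convex_hull_affine_independent[OF affine_independent_2]
  using v_neq_w by (intro the_equality) auto

lemma circumcenter_edge: "circumcenter edge = v + (d / 2) *\<^sub>R u"
proof (rule circumcenter_convex_hull[OF affine_independent_2])
  show "v + (d / 2) *\<^sub>R u \<in> affine hull {v, w}"
    unfolding affine_hull_edge by blast
  have "norm u = 1" by (simp add: norm_eq_sqrt_inner uu)
  then show "dist (v + (d / 2) *\<^sub>R u) x = d / 2" if "x \<in> {v, w}" for x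
    using that d by (auto simp: dist_norm simp flip: scaleR_diff_left)
qed

lemma circumcenter_vertex: "circumcenter {v} = v"
  using circumcenter_convex_hull[of "{v}" v 0] by (simp add: affine_independent_1)

definition cc where "cc = v + (d / 2) *\<^sub>R u + h *\<^sub>R n"

lemma cc_in: "cc \<in> affine hull {v, w, p}"
  unfolding affine_hull_triangle cc_def by blast

lemma dist_cc: "x \<in> {v, w, p} \<Longrightarrow> dist cc x = sqrt ((d / 2)\<^sup>2 + h\<^sup>2)"
proof -
  have 1: "cc - v = (d / 2) *\<^sub>R u + h *\<^sub>R n" "cc - w = (- d / 2) *\<^sub>R u + h *\<^sub>R n"
    "cc - p = (d / 2 - a) *\<^sub>R u + (h - b) *\<^sub>R n"
    by (simp_all add: cc_def algebra_simps flip: scaleR_add_left)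
  \<comment> \<open>Distances to v and \<open>w\<close> agree by symmetry about the midpoint.
    Equality with the distance to \<open>p\<close> is linear in h once the squares of h cancel, and
    this is that linear equation.\<close>
  have "2 * b * h = a\<^sup>2 - a * d + b\<^sup>2"
    using b by (simp add: circum_height_def)
  then have "(d / 2 - a)\<^sup>2 + (h - b)\<^sup>2 = (d / 2)\<^sup>2 + h\<^sup>2"
    by (simp add: power2_eq_square algebra_simps)
  then have "dist cc v = sqrt ((d / 2)\<^sup>2 + h\<^sup>2)" "dist cc w = sqrt ((d / 2)\<^sup>2 + h\<^sup>2)"
    "dist cc p = sqrt ((d / 2)\<^sup>2 + h\<^sup>2)"
    unfolding dist_norm 1 norm_frame by simp_all
  then show "x \<in> {v, w, p} \<Longrightarrow> dist cc x = sqrt ((d / 2)\<^sup>2 + h\<^sup>2)"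
    by blast
qed

lemma circumcenter_triangle: "circumcenter triangle = v + (d / 2) *\<^sub>R u + h *\<^sub>R n"
  using circumcenter_convex_hull[OF independent_triangle cc_in dist_cc] by (simp add: cc_def)

lemma circumradius_triangle: "circumradius triangle = sqrt ((d / 2)\<^sup>2 + h\<^sup>2)"
  using circumradius_convex_hull[OF independent_triangle cc_in dist_cc] by simp

text \<open>The circumcenter of an edge is its midpoint, on the same side of v as \<open>w\<close>;
  the separating normal is u. Signs in a chain therefore come from the triangle alone.\<close>

lemma side_sign_vertex_edge: "side_sign {v} edge = 1"
proof -
  have "affine hull {v} = affine hull {v, w} \<inter> {z. u \<bullet> z = u \<bullet> v}"
    by (auto simp: affine_hull_edge inner_add frame)
  moreover have "v + (d / 2) *\<^sub>R u \<in> affine hull {v, w}" "w \<in> affine hull {v, w}"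
    unfolding affine_hull_edge by blast+
  ultimately have "same_side edge {v} (v + (d / 2) *\<^sub>R u) w"
    unfolding same_side_def affine_hull_convex_hull
    using d by (intro exI[of _ u] exI[of _ "u \<bullet> v"] conjI; (assumption | simp add: inner_add frame))
  then show ?thesis
    by (simp add: side_sign_def circumcenter_edge opposite_vertex_edge)
qed

lemma side_sign_edge_triangle: "side_sign edge triangle = (if 0 < h then 1 else -1)"
proof -
  have "same_side triangle edge cc p \<longleftrightarrow> 0 < h"
  proof
    assume "0 < h"
    have "affine hull {v, w} \<subseteq> affine hull {v, w, p}"
      by (intro hull_mono) auto
    then have "affine hull {v, w} = affine hull {v, w, p} \<inter> {z. n \<bullet> z = n \<bullet> v}"
      by (auto simp: inner_n_edge) (auto simp: affine_hull_edge affine_hull_triangle inner_add frame)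
    moreover have "p \<in> affine hull {v, w, p}"
      by (simp add: hull_inc)
    ultimately show "same_side triangle edge cc p"
      unfolding same_side_def affine_hull_convex_hull using b cc_in \<open>0 < h\<close>
      by (intro exI[of _ n] exI[of _ "n \<bullet> v"]) (auto simp: cc_def inner_add frame)
  next
    assume "same_side triangle edge cc p"
    then obtain m c where *: "affine hull {v, w} = affine hull {v, w, p} \<inter> {z. m \<bullet> z = c}"
        "c < m \<bullet> cc" "c < m \<bullet> p"
      unfolding same_side_def affine_hull_convex_hull by auto
    \<comment> \<open>An arbitrary separating functional m is constant on the edge, hence kills u;
      on the plane it then varies only with the n-coordinate. The position of \<open>p\<close> fixes
      the sign of m on n, and that of \<open>cc\<close> transfers it to h.\<close>
    have "v \<in> affine hull {v, w}" "w \<in> affine hull {v, w}"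
      by (auto simp: hull_inc)
    then have mv: "m \<bullet> v = c" and "m \<bullet> w = c" using *(1) by auto
    then have "m \<bullet> u = 0" using d by (simp add: inner_add)
    then have "0 < b * (m \<bullet> n)" "0 < h * (m \<bullet> n)"
      using * mv by (simp_all add: inner_add cc_def)
    then show "0 < h" using b
      by (simp add: zero_less_mult_iff)
  qed
  then show ?thesis
    by (simp add: side_sign_def circumcenter_triangle opposite_vertex_triangle cc_def)
qed

lemma planar_area_elementary_dual:
  "planar_area (elementary_dual {v} edge triangle) = d * \<bar>h\<bar> / 4"
proof -
  have eq: "v - (v + (d / 2) *\<^sub>R u) = (- d / 2) *\<^sub>R u + 0 *\<^sub>R n"
    "v - cc = (- d / 2) *\<^sub>R u + (- h) *\<^sub>R n"
    "(v + (d / 2) *\<^sub>R u) - cc = 0 *\<^sub>R u + (- h) *\<^sub>R n"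
    by (simp_all add: cc_def)
  define z where "z = sqrt ((d / 2)\<^sup>2 + h\<^sup>2)"
  have dists: "dist v (v + (d / 2) *\<^sub>R u) = d / 2" "dist v cc = z"
    "dist (v + (d / 2) *\<^sub>R u) cc = \<bar>h\<bar>"
    unfolding dist_norm eq norm_frame z_def using d by (simp_all)
  define x where "x = d / 2"
  define y where "y = \<bar>h\<bar>"
  have z2: "z * z = x * x + y * y"
    by (simp add: z_def x_def y_def power2_eq_square)
  define s where "s = (y + z + x) / 2"
  \<comment> \<open>Heron's product for a right triangle with legs x, y and hypotenuse z: grouped in
    this way, Pythagoras makes both factors equal to the area.\<close>
  have "s * (s - z) = x * y / 2" "(s - y) * (s - x) = x * y / 2"
    unfolding s_def using z2 by (simp_all add: field_simps)
  moreover have "s * (s - y) * (s - z) * (s - x) = (s * (s - z)) * ((s - y) * (s - x))"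
    by simp
  ultimately have "s * (s - y) * (s - z) * (s - x) = (x * y / 2)\<^sup>2"
    by (simp only: power2_eq_square)
  moreover have "0 \<le> x * y / 2" using d by (simp add: x_def y_def)
  ultimately have "sqrt (s * (s - y) * (s - z) * (s - x)) = x * y / 2"
    by simp
  then show ?thesis
    unfolding elementary_dual_def circumcenter_vertex circumcenter_edge circumcenter_triangle
      cc_def[symmetric] planar_area_triangle dists
    by (simp add: s_def x_def y_def)
qed

text \<open>The sign turns the absolute value of h into h. At h = 0 the sign is -1, but the area
  vanishes.\<close>

lemma chain_contribution:
  "side_sign {v} edge * side_sign edge triangle * planar_area (elementary_dual {v} edge triangle)
     = d * h / 4"
  by (simp add: side_sign_vertex_edge side_sign_edge_triangle planar_area_elementary_dual)

end

lemma triangle_frame_exists: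
  fixes v u q :: "'a::euclidean_space"
  assumes "u \<bullet> u = 1" "0 < d" "q \<notin> affine hull {v, v + d *\<^sub>R u}"
  obtains n a b where "triangle_frame u n d b" "q = v + a *\<^sub>R u + b *\<^sub>R n"
proof -
  \<comment> \<open>One Gram-Schmidt step: a is the component along u, and the remainder y is
    nonzero because q is off the edge line.\<close>
  define a where "a = (q - v) \<bullet> u"
  define y where "y = q - v - a *\<^sub>R u"
  have yu: "u \<bullet> y = 0"
    using assms(1) by (simp add: y_def a_def inner_diff inner_commute)
  have "y \<noteq> 0"
  proof
    assume "y = 0"
    then have "q = (1 - a / d) *\<^sub>R v + (a / d) *\<^sub>R (v + d *\<^sub>R u)"
      using assms(2) by (simp add: y_def algebra_simps)
    then show False
      using assms(3) unfolding affine_hull_2 by force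
  qed
  then have "triangle_frame u (y /\<^sub>R norm y) d (norm y)"
    using assms yu by unfold_locales (simp_all add: power2_norm_eq_inner[symmetric] power2_eq_square)
  moreover have "q = v + a *\<^sub>R u + norm y *\<^sub>R (y /\<^sub>R norm y)"
    using \<open>y \<noteq> 0\<close> by (simp add: y_def)
  ultimately show ?thesis using that by blast
qed

section \<open>Unfolding two adjacent triangles into the plane\<close>

text \<open>The unfolding reads L in the frame (u, n) and R in the frame (u, n'), sending n to j but
  n' to -j so that the opposite vertices land on opposite sides. On the common edge both normal
  coordinates vanish, so the two formulas agree.\<close>

lemma flattening_exists:
  fixes v u n n' :: "'a::euclidean_space" and d a b a' b' :: real
  defines "w \<equiv> v + d *\<^sub>R u"
  defines "p \<equiv> v + a *\<^sub>R u + b *\<^sub>R n" and "q \<equiv> v + a' *\<^sub>R u + b' *\<^sub>R n'"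
  defines "e \<equiv> convex hull {v, w}"
  defines "L \<equiv> convex hull {v, w, p}" and "R \<equiv> convex hull {v, w, q}"
  defines "i \<equiv> axis 1 1 :: real^2" and "j \<equiv> axis 2 1 :: real^2"
  assumes L: "triangle_frame u n d b" and R: "triangle_frame u n' d b'" and LR: "L \<inter> R = e"
  obtains f :: "'a \<Rightarrow> real^2" where "flattening L R e f"
    "f ` L = convex hull {0, 0 + d *\<^sub>R i, 0 + a *\<^sub>R i + b *\<^sub>R j}"
    "f q = a' *\<^sub>R i - b' *\<^sub>R j"
proof -
  interpret L: triangle_frame v u n d a b by fact
  interpret R: triangle_frame v u n' d a' b' by fact
  have ij: "i \<bullet> i = 1" "j \<bullet> j = 1" "i \<bullet> j = 0"
    by (simp_all add: i_def j_def inner_axis_axis)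
  interpret F: triangle_frame "0 :: real^2" i j d a b
    using L.d L.b ij by unfold_locales
  interpret F': triangle_frame "0 :: real^2" i "- j" d a' b'
    using R.d R.b ij by unfold_locales auto
  define f where "f x = (if x \<in> L then ((x - v) \<bullet> u) *\<^sub>R i + ((x - v) \<bullet> n) *\<^sub>R j
                         else ((x - v) \<bullet> u) *\<^sub>R i + ((x - v) \<bullet> n') *\<^sub>R (- j))" for x
  have fL: "f x = ((x - v) \<bullet> u) *\<^sub>R i + ((x - v) \<bullet> n) *\<^sub>R j" if "x \<in> L" for x
    using that by (simp add: f_def)
  have fR: "f x = ((x - v) \<bullet> u) *\<^sub>R i + ((x - v) \<bullet> n') *\<^sub>R (- j)" if "x \<in> R" for x
  proof (cases "x \<in> L")
    case True
    then have "x \<in> affine hull {v, w}"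
      using that LR convex_hull_subset_affine_hull unfolding e_def by blast
    then have "(x - v) \<bullet> n = 0" "(x - v) \<bullet> n' = 0"
      using L.inner_n_edge[of x] R.inner_n_edge[of x]
      by (simp_all add: inner_diff inner_commute w_def)
    then show ?thesis using True by (simp add: fL)
  qed (simp add: f_def)
  \<comment> \<open>Stated for an arbitrary source frame and an arbitrary target frame, so that it
    applies to L with (i, j) and to R with (i, -j).\<close>
  have iso: "dist ((((x - v) \<bullet> y) *\<^sub>R k + ((x - v) \<bullet> m) *\<^sub>R l) :: real^2)
               ((((x' - v) \<bullet> y) *\<^sub>R k + ((x' - v) \<bullet> m) *\<^sub>R l)) = dist x x'"
    if "triangle_frame y m d \<beta>" "triangle_frame k l d \<beta>"
      "x \<in> convex hull {v, v + d *\<^sub>R y, v + \<alpha> *\<^sub>R y + \<beta> *\<^sub>R m}"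
      "x' \<in> convex hull {v, v + d *\<^sub>R y, v + \<alpha> *\<^sub>R y + \<beta> *\<^sub>R m}" for x x' y m k l \<alpha> \<beta>
  proof -
    interpret X: triangle_frame v y m d \<alpha> \<beta> by fact
    interpret Y: triangle_frame "0 :: real^2" k l d \<alpha> \<beta> by fact
    have "x \<in> affine hull {v, X.w, X.p}" "x' \<in> affine hull {v, X.w, X.p}"
      using that convex_hull_subset_affine_hull by blast+
    then obtain s t s' t' where x: "x = v + s *\<^sub>R y + t *\<^sub>R m" "x' = v + s' *\<^sub>R y + t' *\<^sub>R m"
      unfolding X.affine_hull_triangle by blast
    have "x - x' = (s - s') *\<^sub>R y + (t - t') *\<^sub>R m"
      by (simp add: x algebra_simps)
    moreover have "(((x - v) \<bullet> y) *\<^sub>R k + ((x - v) \<bullet> m) *\<^sub>R l) -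
               ((((x' - v) \<bullet> y) *\<^sub>R k + ((x' - v) \<bullet> m) *\<^sub>R l)) = (s - s') *\<^sub>R k + (t - t') *\<^sub>R l"
      by (simp add: x inner_add X.frame algebra_simps)
    ultimately show ?thesis
      by (simp only: dist_norm X.norm_frame Y.norm_frame)
  qed
  have isoL: "isometric_on L f"
    using iso[OF L F.triangle_frame_axioms] unfolding isometric_on_def
    by (simp add: fL) (simp add: L_def p_def w_def)
  have isoR: "isometric_on R f"
    using iso[OF R F'.triangle_frame_axioms] unfolding isometric_on_def
    by (simp add: fR) (simp add: R_def q_def w_def)
  have in_L: "v \<in> L" "w \<in> L" "p \<in> L" and "q \<in> R"
    by (auto simp: L_def R_def hull_inc)
  then have f: "f v = 0" "f w = 0 + d *\<^sub>R i" "f p = 0 + a *\<^sub>R i + b *\<^sub>R j"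
    "f q = a' *\<^sub>R i - b' *\<^sub>R j"
    by (simp_all add: fL fR) (simp_all add: w_def p_def q_def inner_add L.frame R.frame)
  have "f ` L = convex hull (f ` {v, w, p})"
    unfolding L_def by (rule isometric_on_convex_hull) (use isoL L_def in simp)
  then have fimL: "f ` L = convex hull {0, 0 + d *\<^sub>R i, 0 + a *\<^sub>R i + b *\<^sub>R j}"
    by (simp add: f)
  have "e \<subseteq> L"
    using LR by blast
  then have "isometric_on (convex hull {v, w}) f"
    using isoL by (auto simp: isometric_on_def e_def)
  then have fime: "f ` e = convex hull {0, 0 + d *\<^sub>R i}"
    unfolding e_def by (subst isometric_on_convex_hull) (auto simp: f)
  have opp: "opposite_vertex L e = p" "opposite_vertex R e = q"
    using L.opposite_vertex_triangle R.opposite_vertex_triangle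
    by (simp_all add: L_def R_def e_def p_def q_def w_def)
  \<comment> \<open>The flattened L spans the whole plane, so every point has frame coordinates and
    the edge line is exactly the zero set of the j-coordinate.\<close>
  have UNIV: "affine hull {0, 0 + d *\<^sub>R i, 0 + a *\<^sub>R i + b *\<^sub>R j} = (UNIV :: (real^2) set)"
    using F.independent_triangle F.v_neq_w F.p_notin
    by (intro affine_independent_span_eq) (auto simp: card_insert_if hull_inc)
  have "z \<in> affine hull {0, 0 + d *\<^sub>R i}" if "j \<bullet> z = 0" for z
  proof -
    have "z \<in> affine hull {0, 0 + d *\<^sub>R i, 0 + a *\<^sub>R i + b *\<^sub>R j}"
      by (simp only: UNIV UNIV_I)
    then show ?thesis
      using that unfolding F.affine_hull_triangle F.affine_hull_edge
      by (auto simp: inner_add F.frame)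
  qed
  then have "affine hull {0, 0 + d *\<^sub>R i} = UNIV \<inter> {z. (- j) \<bullet> z = 0}"
    using F.inner_n_edge by auto
  then have "opposite_sides UNIV (f ` e) (f p) (f q)"
    unfolding opposite_sides_def fime affine_hull_convex_hull
    using L.b R.b
    \<comment> \<open>\<open>opposite_sides\<close> wants its first point on the lower side; under
      -j the values at f p and f q are -b and b'.\<close>
    by (intro exI[of _ "- j"] exI[of _ 0]) (simp add: f inner_add inner_diff_right F.frame)
  then have "flattening L R e f"
    using isoL isoR by (simp add: flattening_def opp)
  then show ?thesis
    using that fimL f by blast
qed

text \<open>After unfolding, the circumcenter of L is (d/2, h) and the opposite vertex of R is (a',
  -b'). The power of that vertex with respect to the circumcircle is a'^2 - a' d + b'^2 + 2 b' h = 2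
  b' (h + h'), with h' the height for R, so being outside the circle decides the sign of h +
  h'.\<close>

lemma delaunay_heights:
  fixes v u n n' :: "'a::euclidean_space" and d a b a' b' :: real
  defines "w \<equiv> v + d *\<^sub>R u"
  defines "p \<equiv> v + a *\<^sub>R u + b *\<^sub>R n" and "q \<equiv> v + a' *\<^sub>R u + b' *\<^sub>R n'"
  defines "e \<equiv> convex hull {v, w}"
  defines "L \<equiv> convex hull {v, w, p}" and "R \<equiv> convex hull {v, w, q}"
  assumes L: "triangle_frame u n d b" and R: "triangle_frame u n' d b'" and LR: "L \<inter> R = e"
    and del: "\<And>f :: 'a \<Rightarrow> real^2. flattening L R e f \<Longrightarrow>
      circumradius (f ` L) < dist (circumcenter (f ` L)) (f (opposite_vertex R e))"
  shows "0 < circum_height d a b + circum_height d a' b'"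
proof -
  define i j :: "real^2" where "i = axis 1 1" and "j = axis 2 1"
  interpret L: triangle_frame v u n d a b by fact
  interpret R: triangle_frame v u n' d a' b' by fact
  interpret F: triangle_frame "0 :: real^2" i j d a b
    using L.d L.b by unfold_locales (simp_all add: i_def j_def inner_axis_axis)
  obtain f :: "'a \<Rightarrow> real^2" where f: "flattening L R e f" "f ` L = F.triangle"
      "f q = a' *\<^sub>R i - b' *\<^sub>R j"
    using flattening_exists[OF L R] LR
    unfolding L_def R_def e_def p_def q_def w_def i_def j_def by metis
  have opp: "opposite_vertex R e = q"
    using R.opposite_vertex_triangle by (simp add: R_def e_def q_def w_def)
  define h where "h = circum_height d a b"
  have eq: "0 + (d / 2) *\<^sub>R i + h *\<^sub>R j - (a' *\<^sub>R i - b' *\<^sub>R j) = (d / 2 - a') *\<^sub>R i + (h + b') *\<^sub>R j"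
    by (simp add: algebra_simps)
  have "sqrt ((d / 2)\<^sup>2 + h\<^sup>2) < sqrt ((d / 2 - a')\<^sup>2 + (h + b')\<^sup>2)"
    using del[OF f(1)] unfolding f(2) opp f(3) F.circumradius_triangle F.circumcenter_triangle
      dist_norm h_def[symmetric] eq F.norm_frame .
  then have "(d / 2)\<^sup>2 + h\<^sup>2 < (d / 2 - a')\<^sup>2 + (h + b')\<^sup>2"
    by simp
  then have "0 < a'\<^sup>2 - a' * d + b'\<^sup>2 + 2 * b' * h"
    by (simp add: power2_eq_square algebra_simps)
  moreover have "a'\<^sup>2 - a' * d + b'\<^sup>2 = 2 * b' * circum_height d a' b'"
    using R.b by (simp add: circum_height_def)
  ultimately have "0 < 2 * b' * (h + circum_height d a' b')"
    by (simp add: distrib_left)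
  then show ?thesis
    using R.b by (simp add: zero_less_mult_iff h_def)
qed

section \<open>Edges and triangles around an internal vertex\<close>

text \<open>The inverse chart injects an open planar set continuously into the affine hull of S.
  Invariance of dimension forces that hull to be a plane, and invariance of domain makes the image
  open in it. This later excludes that a single simplex covers a neighbourhood of a point on a
  proper face of it.\<close>

lemma planar_neighbourhood_rel_interior:
  fixes S X :: "'a::euclidean_space set" and V :: "(real^2) set"
  assumes U: "openin (top_of_set X) U" "x \<in> U" "U homeomorphic V" and V: "open V"
    and W: "open W" "x \<in> W" "X \<inter> W \<subseteq> S" and dim: "aff_dim S \<le> 2"
  shows "aff_dim S = 2" "x \<in> rel_interior S"
proof -
  obtain k g where "homeomorphism U V k g"
    using U(3) unfolding homeomorphic_def by blast
  then have kg: "homeomorphism V U g k"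
    by (rule homeomorphism_symD)
  have g: "continuous_on V g" "g ` V = U"
    using kg by (simp_all add: homeomorphism_def)
  have "inj_on g V"
    using kg by (intro inj_on_inverseI[of _ k]) (simp add: homeomorphism_def)
  note g = g this
  \<comment> \<open>The chart domain is shrunk until its image lies in W, hence in S.\<close>
  define V' where "V' = V \<inter> g -` W"
  have V': "open V'"
    unfolding V'_def using g V W(1) by (simp add: continuous_open_preimage)
  have xin: "x \<in> g ` V'"
    using U(2) W(2) unfolding g(2)[symmetric] V'_def by blast
  have sub: "g ` V' \<subseteq> S"
    using openin_imp_subset[OF U(1)] g(2) W(3) by (auto simp: V'_def)
  then have into: "g \<in> V' \<rightarrow> affine hull S"
    using hull_subset[of S affine] by blast
  have cont: "continuous_on V' g" and inj: "inj_on g V'"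
    using continuous_on_subset[OF g(1)] inj_on_subset[OF g(3)] by (auto simp: V'_def)
  have "aff_dim (UNIV :: (real^2) set) \<le> aff_dim (affine hull S)"
  proof (rule invariance_of_dimension_affine_sets[OF _ _ _ cont into inj])
    show "openin (top_of_set UNIV) V'" using V' by simp
    show "V' \<noteq> {}" using xin by blast
  qed simp_all
  then show "aff_dim S = 2"
    using dim by simp
  then have "openin (top_of_set (affine hull S)) (g ` V')"
    using V' by (intro invariance_of_domain_affine_sets[where U = UNIV, OF _ _ _ _ cont into inj])
      simp_all
  then show "x \<in> rel_interior S"
    using xin sub unfolding rel_interior_def by blast
qed

lemma open_star:
  assumes "finite K" "\<And>\<sigma>. \<sigma> \<in> K \<Longrightarrow> closed \<sigma>"
  obtains W where "open W" "x \<in> W" "\<Union>K \<inter> W \<subseteq> \<Union>{\<sigma>\<in>K. x \<in> \<sigma>}"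
proof
  \<comment> \<open>Only finitely many closed simplices miss x, so the complement of their union is
    open.\<close>
  show "open (- \<Union>{\<sigma>\<in>K. x \<notin> \<sigma>})"
    using assms by (intro open_Compl closed_Union) auto
qed auto

lemma simplicial_complex_face:
  "simplicial_complex K \<Longrightarrow> S \<in> K \<Longrightarrow> F face_of S \<Longrightarrow> F \<in> K"
  by (auto simp: simplicial_complex_def)

lemma simplicial_complex_Int:
  "simplicial_complex K \<Longrightarrow> S \<in> K \<Longrightarrow> S' \<in> K \<Longrightarrow> S \<inter> S' face_of S"
  by (auto simp: simplicial_complex_def)

lemma edge_at_vertex:
  fixes v :: "'a::euclidean_space"
  assumes "1 simplex e" "{v} face_of e"
  obtains w where "v \<noteq> w" "e = convex hull {v, w}"
proof -
  obtain C where C: "\<not> affine_dependent C" "int (card C) = 1 + 1" "e = convex hull C"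
    using assms(1) unfolding simplex_def by blast
  then have "v \<in> C"
    using assms(2) by (simp add: face_of_singleton extreme_point_of_convex_hull_affine_independent)
  moreover have "card C = 2" using C(2) by simp
  ultimately obtain w where "C = {v, w}" "v \<noteq> w"
    by (auto simp: card_2_iff)
  then show ?thesis using that C(3) by blast
qed

lemma triangle_at_edge:
  fixes v w :: "'a::euclidean_space"
  assumes "2 simplex t" "convex hull {v, w} face_of t" "v \<noteq> w"
  obtains q where "q \<notin> affine hull {v, w}" "t = convex hull {v, w, q}"
proof -
  obtain C where C: "\<not> affine_dependent C" "int (card C) = 2 + 1" "t = convex hull C"
    using assms(1) unfolding simplex_def by blast
  then obtain c where c: "c \<subseteq> C" "convex hull {v, w} = convex hull c"
    using assms(2) face_of_convex_hull_affine_independent by blast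
  then have "\<not> affine_dependent c"
    using C(1) affine_dependent_subset by blast
  \<comment> \<open>An affinely independent set is recovered from its hull as the set of extreme
    points, so equal hulls give equal vertex sets.\<close>
  then have "x \<in> c \<longleftrightarrow> x \<in> {v, w}" for x
    using extreme_point_of_convex_hull_affine_independent[of c x] c(2)
      extreme_point_of_convex_hull_affine_independent[OF affine_independent_2, of x v w] by simp
  then have c_eq: "c = {v, w}" by blast
  have "card C = 3" using C(2) by simp
  then have "card (C - {v, w}) = 1"
    using c(1) c_eq assms(3) by (simp add: card_Diff_subset)
  then obtain q where q: "C - {v, w} = {q}"
    by (auto simp: card_1_singleton_iff)
  then have Cq: "C = {v, w, q}" "C - {q} = {v, w}" "q \<in> C"
    using c(1) c_eq by blast+
  then have "q \<notin> affine hull {v, w}"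
    using C(1) unfolding affine_dependent_def by auto
  then show ?thesis
    using that C(3) Cq(1) by blast
qed

lemma internal_vertex_chart:
  assumes "internal_vertex K {v}"
  obtains U and V :: "(real^2) set" where "openin (top_of_set (\<Union>K)) U" "v \<in> U"
    "open V" "U homeomorphic V"
proof -
  have "v \<in> \<Union>K" "v \<notin> surface_boundary (\<Union>K)"
    using assms by (auto simp: internal_vertex_def)
  then show ?thesis
    using that unfolding surface_boundary_def by blast
qed

lemma triangle_mesh_closed:
  "triangle_mesh K \<Longrightarrow> \<sigma> \<in> K \<Longrightarrow> closed \<sigma>"
  unfolding triangle_mesh_def simplicial_complex_def by (meson closed_simplex)

text \<open>Without an edge at v, every simplex through v collapses to {v}, so v would be an
  isolated point of the mesh, which no planar chart allows.\<close>

lemma internal_vertex_edge_exists: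
  assumes K: "triangle_mesh K" and v: "internal_vertex K {v}"
  shows "\<exists>e\<in>K. 1 simplex e \<and> {v} face_of e"
proof (rule ccontr)
  assume no: "\<not> ?thesis"
  have sc: "simplicial_complex K" using K by (simp add: triangle_mesh_def)
  obtain U and V :: "(real^2) set" where UV: "openin (top_of_set (\<Union>K)) U" "v \<in> U"
    "open V" "U homeomorphic V"
    using internal_vertex_chart[OF v] .
  obtain W where W: "open W" "v \<in> W" "\<Union>K \<inter> W \<subseteq> \<Union>{\<sigma>\<in>K. v \<in> \<sigma>}"
    using open_star[of K v] sc triangle_mesh_closed[OF K] unfolding simplicial_complex_def by blast
  have "\<sigma> \<subseteq> {v}" if \<sigma>: "\<sigma> \<in> K" "v \<in> \<sigma>" for \<sigma>
  proof -
    have "\<sigma> \<inter> {v} face_of \<sigma>"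
      using simplicial_complex_Int[OF sc \<sigma>(1), of "{v}"] v by (simp add: internal_vertex_def)
    then have ext: "v extreme_point_of \<sigma>"
      using \<sigma> by (simp add: face_of_singleton)
    obtain m where "m simplex \<sigma>"
      using sc \<sigma> unfolding simplicial_complex_def by blast
    then obtain C where C: "\<not> affine_dependent C" "\<sigma> = convex hull C"
      by (auto simp: simplex_def)
    have "v \<in> C"
      using ext unfolding C(2) extreme_point_of_convex_hull_affine_independent[OF C(1)] .
    have "C \<subseteq> {v}"
    proof (rule ccontr)
      assume "\<not> C \<subseteq> {v}"
      \<comment> \<open>A second vertex y of \<sigma> spans with v a face of \<sigma>, which belongs
        to K and is an edge at v.\<close>
      then obtain y where "y \<in> C" "y \<noteq> v" by blast
      then have "{v, y} \<subseteq> C"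
        using \<open>v \<in> C\<close> by simp
      then have "convex hull {v, y} face_of \<sigma>"
        unfolding C(2) face_of_convex_hull_affine_independent[OF C(1)] by (intro exI[of _ "{v, y}"]) simp
      then have "convex hull {v, y} \<in> K"
        by (rule simplicial_complex_face[OF sc \<sigma>(1)])
      moreover have "{v} face_of convex hull {v, y}"
        unfolding face_of_singleton extreme_point_of_convex_hull_2 by simp
      moreover have "1 simplex convex hull {v, y}"
        using \<open>y \<noteq> v\<close> one_simplex_segment[of v y] unfolding segment_convex_hull by simp
      ultimately have "\<exists>e\<in>K. 1 simplex e \<and> {v} face_of e"
        by (intro bexI conjI)
      with no show False by (rule notE)
    qed
    then show ?thesis
      unfolding C(2) by (rule hull_minimal) simp
  qed
  then have "\<Union>{\<sigma>\<in>K. v \<in> \<sigma>} \<subseteq> {v}"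
    by (intro Union_least) blast
  with W(3) have "\<Union>K \<inter> W \<subseteq> {v}"
    by (rule subset_trans)
  then have "aff_dim {v} = 2"
    by (rule planar_neighbourhood_rel_interior(1)[OF UV(1,2,4,3) W(1,2)]) simp
  then show False by simp
qed

lemma internal_vertex_edge_two_triangles:
  assumes K: "triangle_mesh K" and v: "internal_vertex K {v}"
    and e: "e \<in> K" "1 simplex e" "{v} face_of e"
  shows "\<exists>L R. L \<noteq> R \<and> L \<in> K \<and> R \<in> K \<and> 2 simplex L \<and> 2 simplex R \<and> e face_of L \<and> e face_of R"
proof (rule ccontr)
  assume no: "\<not> ?thesis"
  have sc: "simplicial_complex K" using K by (simp add: triangle_mesh_def)
  obtain U and V :: "(real^2) set" where UV: "openin (top_of_set (\<Union>K)) U" "v \<in> U"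
    "open V" "U homeomorphic V"
    using internal_vertex_chart[OF v] .
  obtain Q where Q: "open Q" "U = \<Union>K \<inter> Q"
    using UV(1) by (auto simp: openin_open)
  have "convex e" using e(2) convex_simplex by blast
  \<comment> \<open>The chart is available only near v, while the star of v itself is too large. A
    point x in the relative interior of e and close to v lies in the chart, and its star involves
    only e and the triangles on e.\<close>
  then have "v \<in> closure (rel_interior e)"
    using e(3) face_of_imp_subset closure_subset[of e] by (fastforce simp: convex_closure_rel_interior)
  then have "Q \<inter> rel_interior e \<noteq> {}"
    using open_Int_closure_eq_empty[OF Q(1)] UV(2) Q(2) by blast
  then obtain x where x: "x \<in> Q" "x \<in> rel_interior e" by blast
  then have "x \<in> e" using rel_interior_subset by blast
  then have "x \<in> U" using x e Q by blast
  obtain W where W: "open W" "x \<in> W" "\<Union>K \<inter> W \<subseteq> \<Union>{\<sigma>\<in>K. x \<in> \<sigma>}"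
    using open_star[of K x] sc triangle_mesh_closed[OF K] unfolding simplicial_complex_def by blast
  define T where "T = {t\<in>K. 2 simplex t \<and> e face_of t}"
  have star: "\<sigma> = e \<or> \<sigma> \<in> T" if \<sigma>: "\<sigma> \<in> K" "x \<in> \<sigma>" for \<sigma>
  proof (cases "\<sigma> = e")
    case False
    have "e \<inter> \<sigma> face_of e" and f: "\<sigma> \<inter> e face_of \<sigma>"
      using simplicial_complex_Int[OF sc] \<sigma>(1) e(1) by blast+
    \<comment> \<open>A face of e that meets the relative interior of e is all of e; hence e is a
      face of every simplex through x, and the dimension bound leaves only triangles besides
      e.\<close>
    then have "e \<inter> \<sigma> = e"
      using face_of_disjoint_rel_interior x(2) \<sigma>(2) \<open>x \<in> e\<close> by blast
    with f have face: "e face_of \<sigma>" by (simp add: Int_commute)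
    obtain n where n: "n simplex \<sigma>"
      using sc \<sigma> unfolding simplicial_complex_def by blast
    have "aff_dim e < aff_dim \<sigma>"
      using face False n convex_simplex face_of_aff_dim_lt by blast
    moreover have "aff_dim \<sigma> \<le> 2"
      using K \<sigma> by (simp add: triangle_mesh_def)
    ultimately have "n = 2"
      using aff_dim_simplex[OF n] aff_dim_simplex[OF e(2)] by linarith
    then show ?thesis using \<sigma> n face by (simp add: T_def)
  qed blast
  \<comment> \<open>If S alone covered a neighbourhood of x, it would be two-dimensional with x in
    its relative interior. The edge e has the wrong dimension, and in a triangle x lies on the
    proper face e.\<close>
  have contra: False if S: "S = e \<or> S \<in> T" and sub: "\<Union>K \<inter> W \<subseteq> S" for S
  proof -
    have "S \<in> K" using S e by (auto simp: T_def)
    then have "aff_dim S \<le> 2" using K by (simp add: triangle_mesh_def)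
    note S2 = planar_neighbourhood_rel_interior[OF UV(1) \<open>x \<in> U\<close> UV(4,3) W(1,2) sub this]
    have "aff_dim e = 1" using aff_dim_simplex[OF e(2)] .
    then have "S \<noteq> e" using S2(1) by auto
    then have "e face_of S" using S by (auto simp: T_def)
    then show False
      using face_of_disjoint_rel_interior \<open>S \<noteq> e\<close> S2(2) \<open>x \<in> e\<close> by blast
  qed
  show False
  proof (cases "T = {}")
    case True
    then show False using contra[of e] star W(3) by blast
  next
    case False
    then obtain t where t: "t \<in> T" by blast
    then have "T = {t}" using no by (auto simp: T_def)
    moreover have "e \<subseteq> t" using t by (simp add: T_def face_of_imp_subset)
    ultimately show False using contra[of t] star W(3) by blast
  qed
qed

section \<open>Summing the contributions of the chains\<close>

text \<open>At most one term can be nonpositive, since every other term must outweigh it. Pairing it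
  with any other term leaves only positive ones.\<close>

lemma sum_pos_if_pairwise_pos:
  fixes f :: "'a \<Rightarrow> real"
  assumes "finite A" "x \<in> A" "y \<in> A" "x \<noteq> y"
    and pos: "\<And>x y. x \<in> A \<Longrightarrow> y \<in> A \<Longrightarrow> x \<noteq> y \<Longrightarrow> 0 < f x + f y"
  shows "0 < sum f A"
proof (cases "\<exists>z\<in>A. f z \<le> 0")
  case True
  then obtain z where z: "z \<in> A" "f z \<le> 0" by blast
  obtain y' where y': "y' \<in> A" "y' \<noteq> z" using assms by blast
  have "0 \<le> sum f (A - {z} - {y'})"
    using pos[of z] z by (intro sum_nonneg) fastforce
  moreover have "sum f A = f z + (f y' + sum f (A - {z} - {y'}))"
    using assms(1) z y' by (simp add: sum.remove[of A z] sum.remove[of "A - {z}" y'])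
  ultimately show ?thesis
    using pos[OF z(1) y'(1)] y'(2) by simp
next
  case False
  then show ?thesis
    using assms(1,2) by (intro sum_pos) (auto simp: not_le)
qed

abbreviation chain_term :: "'a::euclidean_space set \<Rightarrow> 'a set \<Rightarrow> 'a set \<Rightarrow> real" where
  "chain_term \<tau> e t \<equiv> side_sign \<tau> e * side_sign e t * planar_area (elementary_dual \<tau> e t)"

lemma chain_term_pair_pos:
  assumes sc: "simplicial_complex K" and del: "pairwise_delaunay K"
    and e: "e \<in> K" "1 simplex e" "{v} face_of e"
    and L: "L \<in> K" "2 simplex L" "e face_of L" and R: "R \<in> K" "2 simplex R" "e face_of R"
    and "L \<noteq> R"
  shows "0 < chain_term {v} e L + chain_term {v} e R"
proof -
  obtain w where w: "v \<noteq> w" "e = convex hull {v, w}"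
    using edge_at_vertex e by blast
  \<comment> \<open>Length and unit direction of the edge are fixed first, so that the frames of L
    and R share v, u and d and differ only in the opposite vertex.\<close>
  define d where "d = norm (w - v)"
  define u where "u = (w - v) /\<^sub>R d"
  have d: "0 < d" using w by (simp add: d_def)
  then have wu: "w = v + d *\<^sub>R u" and u: "u \<bullet> u = 1"
    by (simp_all add: u_def d_def power2_norm_eq_inner[symmetric] power2_eq_square)
  obtain p where p: "p \<notin> affine hull {v, w}" "L = convex hull {v, w, p}"
    using triangle_at_edge L w by blast
  obtain q where q: "q \<notin> affine hull {v, w}" "R = convex hull {v, w, q}"
    using triangle_at_edge R w by blast
  obtain n a b where fL: "triangle_frame u n d b" "p = v + a *\<^sub>R u + b *\<^sub>R n"
    using triangle_frame_exists[OF u d] p(1) wu by metis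
  obtain n' a' b' where fR: "triangle_frame u n' d b'" "q = v + a' *\<^sub>R u + b' *\<^sub>R n'"
    using triangle_frame_exists[OF u d] q(1) wu by metis
  have LR: "L \<inter> R = e"
  proof (rule ccontr)
    assume ne: "L \<inter> R \<noteq> e"
    have faces: "L \<inter> R face_of L" "R \<inter> L face_of R"
      using simplicial_complex_Int[OF sc] L(1) R(1) by blast+
    have conv: "convex L" "convex R" "convex (L \<inter> R)"
      using L(2) R(2) convex_simplex convex_Int by blast+
    \<comment> \<open>A common face strictly larger than e would have dimension 2 and hence be all
      of L and all of R.\<close>
    have "e \<subseteq> L \<inter> R" using L(3) R(3) face_of_imp_subset by blast
    then have "e face_of L \<inter> R"
      using L(3) face_of_subset by blast
    then have "aff_dim e < aff_dim (L \<inter> R)"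
      using face_of_aff_dim_lt[OF conv(3)] ne by blast
    then have "aff_dim (L \<inter> R) \<ge> 2"
      using aff_dim_simplex[OF e(2)] by linarith
    then have "L \<inter> R = L" "R \<inter> L = R"
      using face_of_aff_dim_lt[OF conv(1) faces(1)] face_of_aff_dim_lt[OF conv(2) faces(2)]
        aff_dim_simplex[OF L(2)] aff_dim_simplex[OF R(2)] by (auto simp: Int_commute)
    then show False using \<open>L \<noteq> R\<close> by blast
  qed
  have "0 < circum_height d a b + circum_height d a' b'"
  proof (rule delaunay_heights[OF fL(1) fR(1)])
    show "convex hull {v, v + d *\<^sub>R u, v + a *\<^sub>R u + b *\<^sub>R n} \<inter>
        convex hull {v, v + d *\<^sub>R u, v + a' *\<^sub>R u + b' *\<^sub>R n'} = convex hull {v, v + d *\<^sub>R u}"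
      using LR p(2) q(2) w(2) wu fL(2) fR(2) by simp
    show "circumradius (f ` (convex hull {v, v + d *\<^sub>R u, v + a *\<^sub>R u + b *\<^sub>R n}))
        < dist (circumcenter (f ` (convex hull {v, v + d *\<^sub>R u, v + a *\<^sub>R u + b *\<^sub>R n})))
           (f (opposite_vertex (convex hull {v, v + d *\<^sub>R u, v + a' *\<^sub>R u + b' *\<^sub>R n'})
                 (convex hull {v, v + d *\<^sub>R u})))"
      if "flattening (convex hull {v, v + d *\<^sub>R u, v + a *\<^sub>R u + b *\<^sub>R n})
        (convex hull {v, v + d *\<^sub>R u, v + a' *\<^sub>R u + b' *\<^sub>R n'}) (convex hull {v, v + d *\<^sub>R u}) f"
      for f :: "'a \<Rightarrow> real^2"
      using del that e L R \<open>L \<noteq> R\<close>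
      unfolding pairwise_delaunay_def fL(2)[symmetric] fR(2)[symmetric] wu[symmetric]
        p(2)[symmetric] q(2)[symmetric] w(2)[symmetric] by blast
  qed
  then have "0 < d * circum_height d a b / 4 + d * circum_height d a' b' / 4"
    using d by (simp flip: add_divide_distrib distrib_left)
  moreover have "chain_term {v} e L = d * circum_height d a b / 4"
    using triangle_frame.chain_contribution[OF fL(1), of v a]
    by (simp only: p(2) w(2) wu fL(2))
  moreover have "chain_term {v} e R = d * circum_height d a' b' / 4"
    using triangle_frame.chain_contribution[OF fR(1), of v a']
    by (simp only: q(2) w(2) wu fR(2))
  ultimately show ?thesis by simp
qed

theorem theorem4:
  fixes K :: "(real^'N) set set" and \<tau> :: "(real^'N) set"
  assumes "CARD('N) \<in> {2, 3}"
    and "triangle_mesh K"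
    and "pairwise_delaunay K"
    and "internal_vertex K \<tau>"
  shows "0 < signed_dual_area K \<tau>"
proof -
  obtain v where v: "\<tau> = {v}"
    using assms(4) by (auto simp: internal_vertex_def simplex_zero)
  have sc: "simplicial_complex K" and fin: "finite K"
    using assms(2) by (auto simp: triangle_mesh_def simplicial_complex_def)
  \<comment> \<open>Chains are grouped by their edge: single terms may be negative, but the sum over
    the triangles on one edge is positive.\<close>
  define E where "E = {e\<in>K. 1 simplex e \<and> {v} face_of e}"
  define T where "T e = {t\<in>K. 2 simplex t \<and> e face_of t}" for e
  have "0 < (\<Sum>t\<in>T e. chain_term {v} e t)" if e: "e \<in> E" for e
  proof -
    obtain L R where "L \<noteq> R" "L \<in> T e" "R \<in> T e"
      using internal_vertex_edge_two_triangles[OF assms(2), of v e] assms(4) v e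
      by (auto simp: E_def T_def)
    then show ?thesis
      using fin e chain_term_pair_pos[OF sc assms(3)]
      by (intro sum_pos_if_pairwise_pos[of _ L R]) (auto simp: E_def T_def)
  qed
  moreover have "E \<noteq> {}"
    using internal_vertex_edge_exists[OF assms(2)] assms(4) v by (auto simp: E_def)
  moreover have "finite E"
    using fin by (simp add: E_def)
  ultimately have "0 < (\<Sum>e\<in>E. \<Sum>t\<in>T e. chain_term {v} e t)"
    by (simp add: sum_pos)
  also have "\<dots> = (\<Sum>(e, t)\<in>Sigma E T. chain_term {v} e t)"
    using fin by (intro sum.Sigma) (auto simp: E_def T_def)
  also have "Sigma E T = dual_chains K {v}"
    by (auto simp: dual_chains_def E_def T_def)
  finally show ?thesis
    by (simp add: signed_dual_area_def v)
qed

end
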